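(* For integers $1\le r\le n$ let $$P(r,n):=\sum_{i=r+1}^{n}\frac{2r(i-r)}{i(i-1)n}$$ (an empty sum being $0$). For $n\ge 3$ let $\mathfrak{m}(n)$ be an integer $r\in[1,n]$ at which $P(\cdot,n)$ reaches its maximum over the integers in $[1,n]$, and let $\mathbf{P}(n):=P(\mathfrak{m}(n),n)$. Put also $\mathfrak{m}(1)=\mathfrak{m}(2)=0$ and $\mathbf{P}(1)=\mathbf{P}(2)=1$. Let $\vartheta:=-\frac12 W_0\left(-\frac{2}{e^2}\right)=0.20318786\ldots$, where $W_0$ is the principal real branch of the Lambert $W$ function. Then: i) The following holds: $$1=\mathbf{P}(1)=\mathbf{P}(2)>\mathbf{P}(3)>\cdots>\mathbf{P}(n)>\mathbf{P}(n+1)>\cdots>2(\vartheta-\vartheta^2);$$ that is, $\mathbf{P}(1)=\mathbf{P}(2)=1$, $\mathbf{P}(n)>\mathbf{P}(n+1)$ for every $n\ge 2$, and $\mathbf{P}(n)>2(\vartheta-\vartheta^2)$ for every $n\geq 1$. ii) $\displaystyle\lim_{n\to\infty}\frac{\mathfrak{m}(n)}{n}=\vartheta$. iii) $\displaystyle\lim_{n\to\infty}P(\lfloor\vartheta n\rfloor,n)=\lim_{n\to\infty}\mathbf{P}(n)=2(\vartheta-\vartheta^2)$.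
   Context: $P(r,n)$ is the probability of success in the best-or-worst secretary problem (success means choosing the best or the worst object) when the number of objects is uniformly distributed on $\{1,\dots,n\}$, the first $r$ objects are rejected, and then the first object better than all, or worse than all, preceding ones is chosen. The values $\mathbf{P}(1)=\mathbf{P}(2)=1$ and $\mathfrak{m}(1)=\mathfrak{m}(2)=0$ are the paper's conventions (accept the first object). The Lambert $W$ function is the inverse of $w\mapsto we^w$; $W_0$ is the real branch with values in $[-1,\infty)$. *)

theory Defs
  imports Complex_Main
begin

text \<open>Meaningful for \<open>1 \<le> r \<le> n\<close>, where all denominators are positive. For \<open>r = 0\<close> the
  value is \<open>0\<close>, which matters only for \<open>r = \<lfloor>\<vartheta> n\<rfloor>\<close> with \<open>n \<le> 4\<close>.\<close>

definition success_prob :: "nat \<Rightarrow> nat \<Rightarrow> real" where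
  "success_prob r n =
     (\<Sum>i = r + 1..n. 2 * real r * (real i - real r) / (real i * (real i - 1) * real n))"

text \<open>The function \<open>w \<mapsto> w e\<^sup>w\<close> is injective on \<open>[-1, \<infinity>)\<close> with range \<open>[-1/e, \<infinity>)\<close>;
  the principal real branch is unspecified below \<open>-1/e\<close>.\<close>

definition Lambert_W0 :: "real \<Rightarrow> real" where
  "Lambert_W0 = the_inv_into {-1..} (\<lambda>w. w * exp w)"

definition theta :: real  (\<open>\<vartheta>\<close>) where
  "\<vartheta> = - (1 / 2) * Lambert_W0 (- 2 / (exp 1)\<^sup>2)"

end

theory Submission
  imports Defs "HOL-Analysis.Harmonic_Numbers"
begin

text \<open>
  The summand splits into partial fractions, which turns \<open>P(r, n)\<close> into
  \<open>(2 r / n) (H\<^sub>n - H\<^sub>r\<^sub>-\<^sub>1 - 1 + (r - 1) / n)\<close>. Comparing harmonic numbers with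
  logarithms then gives, with \<open>f(x) = 2 x (x - 1 - ln x)\<close>, the uniform bounds
  \<open>f(r / n) \<le> P(r, n) \<le> f(r / n) + 2 / n\<close>.

  The derivative of \<open>f\<close> is \<open>2 (2 x - 2 - ln x)\<close>. On \<open>(0, 1)\<close> it vanishes only at \<open>\<vartheta>\<close>,
  because \<open>w = - 2 \<vartheta>\<close> solves \<open>w e\<^sup>w = - 2 / e\<^sup>2\<close>, which says \<open>ln \<vartheta> = 2 \<vartheta> - 2\<close>; and it changes
  sign there from plus to minus. So \<open>f\<close> has on \<open>(0, 1]\<close> the unique maximum point \<open>\<vartheta>\<close>, with
  value \<open>f(\<vartheta>) = 2 (\<vartheta> - \<vartheta>\<^sup>2)\<close>, and the uniform bounds squeeze both \<open>P(\<lfloor>\<vartheta> n\<rfloor>, n)\<close> and the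
  maximum \<open>\<^bold>P(n)\<close> to this value. Since \<open>f\<close> stays away from its maximum outside any
  neighbourhood of \<open>\<vartheta>\<close>, the maximising ratios \<open>m(n) / n\<close> tend to \<open>\<vartheta>\<close>.

  For strict monotonicity, let \<open>2 \<le> r \<le> n\<close> and average \<open>P(r - 1, n)\<close> and \<open>P(r, n)\<close> with
  weights \<open>r / (n + 1)\<close> and \<open>1 - r / (n + 1)\<close>. These weights average the cut-offs \<open>r - 1\<close> and \<open>r\<close>
  to \<open>r n / (n + 1)\<close>, the same proportion of \<open>n\<close> that \<open>r\<close> is of \<open>n + 1\<close>. The harmonic numbers
  then cancel, and the average exceeds \<open>P(r, n + 1)\<close> by
  \<open>2 r / ((n + 1) n\<^sup>2) (1 - r / (n + 1))\<close> (lemma \<open>success_prob_average\<close>). Together with a direct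
  comparison for \<open>r = 1\<close> and \<open>r = n + 1\<close>, this shows for \<open>n \<ge> 3\<close> that no value \<open>P(r, n + 1)\<close>
  reaches \<open>\<^bold>P(n)\<close>. A strictly decreasing sequence stays strictly above its limit, which is the
  lower bound in part (i).
\<close>

section \<open>A closed form for the success probability\<close>

lemma success_prob_eq:
  assumes "1 \<le> r" "r \<le> n"
  shows "success_prob r n =
    2 * real r / real n * (harm n - harm (r - 1) - 1 + (real r - 1) / real n)"
proof -
  obtain s where s: "r = Suc s" using assms by (cases r) auto
  \<comment> \<open>The part of the summand that depends on the summation index is
    \<open>r / i - (r - 1) / (i - 1)\<close>.\<close>
  have sum_eq: "(\<Sum>i = r + 1..n. (real i - real r) / (real i * (real i - 1)))
      = harm n - harm s - 1 + real s / real n"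
    using \<open>r \<le> n\<close>
  proof (induction n rule: dec_induct)
    case base
    show ?case by (simp add: s harm_Suc field_simps)
  next
    case (step k)
    have "k > 0" using step s by simp
    have "(\<Sum>i = r + 1..Suc k. (real i - real r) / (real i * (real i - 1))) =
        harm k - harm s - 1 + real s / real k
          + (real (Suc k) - real r) / (real (Suc k) * (real (Suc k) - 1))"
      using step by simp
    also have "\<dots> = harm (Suc k) - harm s - 1 + real s / real (Suc k)"
      using \<open>k > 0\<close> by (simp add: s harm_Suc divide_simps) (simp add: algebra_simps)
    finally show ?case .
  qed
  have "success_prob r n =
      2 * real r / real n * (\<Sum>i = r + 1..n. (real i - real r) / (real i * (real i - 1)))"
    unfolding success_prob_def sum_distrib_left by (intro sum.cong refl) (simp add: field_simps)
  then show ?thesis unfolding sum_eq by (simp add: s)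
qed

section \<open>The maximal success probability decreases\<close>

text \<open>
  The weights are chosen so that the harmonic parts of the closed forms agree; what remains is a
  rational identity. For \<open>r = 1\<close> it would fail, since the closed form at cut-off \<open>0\<close> does not
  describe \<open>success_prob 0 n = 0\<close>.
\<close>

lemma success_prob_average:
  assumes "2 \<le> r" "r \<le> n"
  shows "real r / (real n + 1) * success_prob (r - 1) n
       + (1 - real r / (real n + 1)) * success_prob r n
     = success_prob r (n + 1)
       + 2 * real r / ((real n + 1) * (real n)\<^sup>2) * (1 - real r / (real n + 1))"
proof -
  obtain s where s: "r = Suc (Suc s)" using assms by (metis add_2_eq_Suc le_Suc_ex)
  define N where "N = real n"
  define R where "R = real s + 1"
  define h :: real where "h = harm n - harm (Suc s) - 1"
  have harm_s: "harm s = harm n - h - 1 - 1 / R"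
    by (simp add: h_def R_def harm_Suc inverse_eq_divide add.commute)
  have pos: "N > 0" "R > 0" using assms s by (auto simp: N_def R_def)
  have r: "real r = R + 1" by (simp add: s R_def)
  have 1: "success_prob (r - 1) n = 2 * R / N * (h + 1 / R + (R - 1) / N)"
    using assms by (subst success_prob_eq) (auto simp: s harm_s R_def N_def)
  have 2: "success_prob r n = 2 * (R + 1) / N * (h + R / N)"
    using assms by (subst success_prob_eq) (auto simp: s R_def N_def h_def)
  have 3: "success_prob r (n + 1) = 2 * (R + 1) / (N + 1) * (h + 1 / (N + 1) + R / (N + 1))"
    using assms
    by (subst success_prob_eq) (auto simp: s harm_Suc R_def N_def h_def inverse_eq_divide add_ac)
  have nz: "N \<noteq> 0" "R \<noteq> 0" "N + 1 \<noteq> 0" using pos by auto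
  define c where "c = 2 * (R + 1) / (N + 1)"
  have weight: "1 - (R + 1) / (N + 1) = (N - R) / (N + 1)"
    using nz by (simp add: field_simps)
  have lower: "(R + 1) / (N + 1) * success_prob (r - 1) n = c * ((R * h + 1 + R * (R - 1) / N) / N)"
  proof -
    have "(R + 1) / (N + 1) * (2 * R / N * z) = c * (R * z / N)" for z
      unfolding c_def using nz by (simp add: divide_simps)
    then have "(R + 1) / (N + 1) * success_prob (r - 1) n = c * (R * (h + 1 / R + (R - 1) / N) / N)"
      unfolding 1 .
    also have "R * (h + 1 / R + (R - 1) / N) = R * h + 1 + R * (R - 1) / N"
      using nz by (simp add: distrib_left)
    finally show ?thesis .
  qed
  have upper: "(N - R) / (N + 1) * success_prob r n = c * ((N - R) * (h + R / N) / N)"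
    unfolding 2 c_def by simp
  have "(R * h + 1 + R * (R - 1) / N) / N + (N - R) * (h + R / N) / N
      = h + (R + 1) / N - R / N\<^sup>2"
    using \<open>N \<noteq> 0\<close> by (simp add: field_simps power2_eq_square)
  also have "\<dots> = (h + 1 / (N + 1) + R / (N + 1)) + (N - R) / ((N + 1) * N\<^sup>2)"
  proof -
    have "(R + 1) / N - R / N\<^sup>2 = (R + 1) / (N + 1) + (N - R) / ((N + 1) * N\<^sup>2)"
      using nz by (simp add: divide_simps power2_eq_square) (simp add: algebra_simps)
    then show ?thesis by (simp add: add_divide_distrib)
  qed
  finally have "c * ((R * h + 1 + R * (R - 1) / N) / N) + c * ((N - R) * (h + R / N) / N)
      = success_prob r (n + 1) + c * ((N - R) / ((N + 1) * N\<^sup>2))"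
    unfolding 3 c_def by (simp only: flip: distrib_left)
  also have "c * ((N - R) / ((N + 1) * N\<^sup>2))
      = 2 * (R + 1) / ((N + 1) * N\<^sup>2) * ((N - R) / (N + 1))"
    by (simp add: c_def)
  finally show ?thesis
    unfolding r N_def[symmetric] weight lower upper .
qed

text \<open>
  The inequality is equivalent to \<open>n / (n + 1) < H\<^sub>n - 1\<close>. From \<open>n = 4\<close> on the right-hand side
  exceeds \<open>1\<close>.
\<close>

lemma success_prob_1_Suc_less:
  assumes "3 \<le> n"
  shows "success_prob 1 (n + 1) < success_prob 1 n"
proof -
  define e :: real where "e = harm n - 1"
  have e: "harm n = 1 + e" by (simp add: e_def)
  have "real n < e * (real n + 1)"
  proof (cases "n = 3")
    case True
    then show ?thesis by (simp add: e_def harm_expand)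
  next
    case False
    then have "harm 4 \<le> (harm n :: real)" using assms by (intro harm_mono) simp
    then have "1 \<le> e" by (simp add: e_def harm_expand)
    have "real n < 1 * (real n + 1)" by simp
    also have "\<dots> \<le> e * (real n + 1)" using \<open>1 \<le> e\<close> by (intro mult_right_mono) auto
    finally show ?thesis .
  qed
  then have "1 / (real n + 1) < e / real n"
    using assms by (simp add: field_simps)
  then have "2 / (real n + 1) * (e + 1 / (real n + 1)) < 2 / (real n + 1) * (e + e / real n)"
    by (intro mult_strict_left_mono) auto
  also have "\<dots> = 2 / real n * e"
    using assms by (simp add: divide_simps) (simp add: algebra_simps)
  also have "\<dots> = success_prob 1 n"
    using assms e by (subst success_prob_eq) (auto simp: harm_expand)
  also have "2 / (real n + 1) * (e + 1 / (real n + 1)) = success_prob 1 (n + 1)"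
    using assms e
    by (subst success_prob_eq) (auto simp: harm_expand harm_Suc inverse_eq_divide add_ac)
  finally show ?thesis .
qed

lemma success_prob_self: "success_prob n n = 0"
  by (simp add: success_prob_def)

lemma success_prob_pos:
  assumes "1 \<le> r" "r < n"
  shows "0 < success_prob r n"
  unfolding success_prob_def using assms by (intro sum_pos) auto

text \<open>
  An average of two numbers does not exceed both, so one of the cut-offs \<open>r - 1\<close> and \<open>r\<close> for
  \<open>n\<close> beats the cut-off \<open>r\<close> for \<open>n + 1\<close>. At the two ends of the range averaging gives no
  strict inequality, and \<open>P(1, n)\<close> itself is large enough.
\<close>

lemma success_prob_Suc_dominated:
  assumes n: "3 \<le> n" and r: "r \<in> {1..n + 1}"
  shows "\<exists>r'\<in>{1..n}. success_prob r (n + 1) < success_prob r' n"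
proof -
  consider "r = 1" | "r = n + 1" | "2 \<le> r" "r \<le> n" using r by fastforce
  then show ?thesis
  proof cases
    case 1
    then show ?thesis using success_prob_1_Suc_less[OF n] n by (intro bexI[of _ 1]) auto
  next
    case 2
    then show ?thesis
      using success_prob_pos[of 1 n] n success_prob_self[of "n + 1"]
      by (intro bexI[of _ 1]) auto
  next
    case 3
    define c where "c = real r / (real n + 1)"
    have c: "0 \<le> c" "c < 1" using 3 by (auto simp: c_def field_simps)
    have "0 < 2 * real r / ((real n + 1) * (real n)\<^sup>2) * (1 - c)"
      using 3 c by (intro mult_pos_pos divide_pos_pos) auto
    with success_prob_average[OF 3]
    have less: "success_prob r (n + 1)
        < c * success_prob (r - 1) n + (1 - c) * success_prob r n"
      by (simp add: c_def)
    have "c * success_prob (r - 1) n + (1 - c) * success_prob r n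
        \<le> max (success_prob (r - 1) n) (success_prob r n)"
      using c by (intro convex_bound_le) auto
    with less have "success_prob r (n + 1) < max (success_prob (r - 1) n) (success_prob r n)"
      by linarith
    moreover have "r - 1 \<in> {1..n}" "r \<in> {1..n}" using 3 by auto
    ultimately show ?thesis by (metis less_max_iff_disj)
  qed
qed

section \<open>The limiting profile\<close>

definition profile :: "real \<Rightarrow> real" where
  "profile x = 2 * x * (x - 1 - ln x)"

text \<open>
  The sequences \<open>H\<^sub>n - ln n\<close> and \<open>H\<^sub>n\<^sub>-\<^sub>1 - ln n\<close> are decreasing and increasing, respectively.
  So \<open>H\<^sub>n - H\<^sub>r\<^sub>-\<^sub>1\<close> lies between \<open>ln (n / r) + 1 / n\<close> and \<open>ln (n / r) + 1 / r\<close>. The error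
  \<open>1 / r\<close> is large for small \<open>r\<close>, but the factor \<open>2 r / n\<close> turns it into \<open>2 / n\<close>.
\<close>

lemma success_prob_bounds:
  assumes "1 \<le> r" "r \<le> n"
  shows "profile (r / n) \<le> success_prob r n"
    and "success_prob r n \<le> profile (r / n) + 2 / n"
proof -
  have inc: "harm (r - 1) - ln (real r) \<le> harm (n - 1) - ln (real n)"
    using \<open>r \<le> n\<close>
  proof (induction n rule: dec_induct)
    case (step k)
    have k: "k \<ge> 1" using step assms by simp
    then obtain j where j: "k = Suc j" by (cases k) auto
    have "ln (real k + 1) - ln (real k) < 1 / real k"
      using k by (intro ln_diff_le_inverse) simp
    moreover have "harm (Suc k - 1) = harm (k - 1) + 1 / real k"
      by (simp add: j harm_Suc inverse_eq_divide)
    ultimately show ?case using step.IH by (simp add: add.commute)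
  qed simp
  have dec: "harm n - ln (real n) \<le> harm r - ln (real r)"
    using decseqD[OF decseq_harm_diff_ln, of "r - 1" "n - 1"] assms by simp
  have n1: "harm n = harm (n - 1) + 1 / real n" and r1: "harm r = harm (r - 1) + 1 / real r"
    using assms harm_Suc[of "n - 1", where 'a = real] harm_Suc[of "r - 1", where 'a = real]
    by (simp_all add: field_simps)
  define x where "x = real r / real n"
  have x: "0 < x" "x \<le> 1" and lnx: "ln x = ln (real r) - ln (real n)"
    using assms by (auto simp: x_def ln_div)
  define b where "b = harm n - harm (r - 1) - 1 + (real r - 1) / real n"
  have b_eq: "b = harm n - harm (r - 1) - 1 + x - 1 / real n"
    by (simp add: b_def x_def diff_divide_distrib)
  have eq: "success_prob r n = 2 * x * b"
    using success_prob_eq[OF assms] by (simp add: x_def b_def)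
  have b: "x - 1 - ln x \<le> b" "b \<le> x - 1 - ln x + 1 / real r - 1 / real n"
    using inc dec n1 r1 unfolding b_eq lnx by linarith+
  show "profile (r / n) \<le> success_prob r n"
    unfolding eq profile_def x_def[symmetric] using b(1) x by (intro mult_left_mono) auto
  have "2 * x * b \<le> 2 * x * (x - 1 - ln x + 1 / real r)"
    using b(2) x by (intro mult_left_mono) (auto intro: order_trans)
  also have "\<dots> = profile x + 2 * x * (1 / real r)"
    by (simp add: profile_def algebra_simps)
  also have "2 * x * (1 / real r) = 2 / n" using assms by (simp add: x_def)
  finally show "success_prob r n \<le> profile (r / n) + 2 / n"
    unfolding eq x_def .
qed

lemma profile_has_derivative:
  assumes "0 < x"
  shows "(profile has_real_derivative 2 * (2 * x - 2 - ln x)) (at x)"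
  unfolding profile_def[abs_def] using assms
  by (auto intro!: derivative_eq_intros simp: field_simps)

lemma continuous_on_profile: "continuous_on {0<..} profile"
  unfolding profile_def[abs_def] by (intro continuous_intros) auto

section \<open>The critical point\<close>

lemma Taylor_le_exp:
  assumes "even n"
  shows "(\<Sum>k<n. x ^ k / fact k) \<le> exp (x :: real)"
proof -
  obtain t where "exp x = (\<Sum>k<n. x ^ k / fact k) + exp t / fact n * x ^ n"
    using Maclaurin_exp_le by blast
  moreover have "0 \<le> exp t / fact n * x ^ n"
    using assms by (simp add: zero_le_even_power)
  ultimately show ?thesis by linarith
qed

lemma inj_on_mult_exp: "inj_on (\<lambda>w :: real. w * exp w) {-1..}"
proof -
  have "x * exp x < y * exp y" if "-1 \<le> x" "x < y" for x y :: real
  proof (rule DERIV_pos_imp_increasing_open[OF \<open>x < y\<close>])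
    fix z assume "x < z"
    have "((\<lambda>w. w * exp w) has_real_derivative (1 + z) * exp z) (at z)"
      by (auto intro!: derivative_eq_intros simp: algebra_simps)
    moreover have "0 < (1 + z) * exp z" using \<open>x < z\<close> \<open>-1 \<le> x\<close> by simp
    ultimately show "\<exists>d. ((\<lambda>w. w * exp w) has_real_derivative d) (at z) \<and> 0 < d" by blast
  qed (intro continuous_intros)
  then have "strict_mono_on {-1..} (\<lambda>w :: real. w * exp w)"
    by (auto intro: strict_mono_onI)
  then show ?thesis by (rule strict_mono_on_imp_inj_on)
qed

text \<open>
  With \<open>w = - 2 x\<close>, the equation \<open>w e\<^sup>w = - 2 / e\<^sup>2\<close> says \<open>x = e\<^bsup>2 x - 2\<^esup>\<close>, and its residual changes
  sign between the two decimals. Sixteen Taylor terms of the exponential settle both signs; at the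
  upper end the lower Taylor bound is applied to the reciprocal \<open>e\<^bsup>2 - 2 x\<^esup>\<close>.
\<close>

lemma theta_bounds_and_fixpoint:
  shows theta_ge: "0.20318786 \<le> \<vartheta>"
    and theta_less: "\<vartheta> < 0.20318787"
    and theta_fixpoint: "\<vartheta> = exp (2 * \<vartheta> - 2)"
proof -
  let ?a = "0.20318786 :: real" and ?b = "0.20318787 :: real"
  have a: "?a \<le> exp (2 * ?a - 2)"
    by (rule order_trans[OF _ Taylor_le_exp[of 16]])
      (simp_all add: lessThan_nat_numeral fact_numeral power_divide)
  have b': "1 / ?b < exp (2 - 2 * ?b)"
    by (rule less_le_trans[OF _ Taylor_le_exp[of 16]])
      (simp_all add: lessThan_nat_numeral fact_numeral power_divide)
  have "exp (2 * ?b - 2) = 1 / exp (2 - 2 * ?b)"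
    by (simp only: exp_diff) simp
  also have "\<dots> < 1 / (1 / ?b)" by (rule divide_strict_left_mono[OF b']) auto
  finally have b: "exp (2 * ?b - 2) < ?b" by simp
  have "\<exists>x. ?a \<le> x \<and> x \<le> ?b \<and> x - exp (2 * x - 2) = 0"
    by (rule IVT') (use a b in \<open>auto intro!: continuous_intros\<close>)
  then obtain x where x: "?a \<le> x" "x \<le> ?b" "x = exp (2 * x - 2)" by auto
  have "x \<noteq> ?b" using x(3) b by force
  have "exp (2 * x - 2) = exp (2 * x) / (exp 1)\<^sup>2"
    by (simp add: exp_diff flip: exp_of_nat_mult)
  then have "x * exp (- 2 * x) = 1 / (exp 1)\<^sup>2"
    using x(3) by (simp add: exp_minus field_simps)
  then have "(- 2 * x) * exp (- 2 * x) = - 2 / (exp 1)\<^sup>2" by simp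
  then have "Lambert_W0 (- 2 / (exp 1)\<^sup>2) = - 2 * x"
    unfolding Lambert_W0_def using x by (intro the_inv_into_f_eq inj_on_mult_exp) auto
  then have "\<vartheta> = x" by (simp add: theta_def)
  then show "?a \<le> \<vartheta>" "\<vartheta> < ?b" "\<vartheta> = exp (2 * \<vartheta> - 2)"
    using x \<open>x \<noteq> ?b\<close> by auto
qed

lemma ln_theta: "ln \<vartheta> = 2 * \<vartheta> - 2"
  using theta_fixpoint by (metis ln_exp)

lemma profile_theta: "profile \<vartheta> = 2 * (\<vartheta> - \<vartheta>\<^sup>2)"
  by (simp add: profile_def ln_theta algebra_simps power2_eq_square)

text \<open>
  Both sign lemmas use only the tangent bound \<open>ln y \<le> y - 1\<close>, applied to the ratio of \<open>x\<close> to one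
  of the two zeros \<open>\<vartheta>\<close> and \<open>1\<close> of \<open>2 x - 2 - ln x\<close>. The slope of the logarithm is above \<open>2\<close> to
  the left of \<open>1/2\<close> and below \<open>2\<close> to the right of it, so the zero on the same side is used.
\<close>

lemma profile_slope_pos:
  assumes "0 < x" "x < \<vartheta>"
  shows "0 < 2 * x - 2 - ln x"
proof -
  have t: "0 < \<vartheta>" "\<vartheta> < 1 / 2" using theta_ge theta_less by auto
  have "ln x - ln \<vartheta> = ln (x / \<vartheta>)" using assms t by (simp add: ln_div)
  also have "\<dots> \<le> x / \<vartheta> - 1" using assms t by (intro ln_le_minus_one) simp
  also have "\<dots> < 2 * (x - \<vartheta>)"
  proof -
    have "0 < (\<vartheta> - x) * (1 - 2 * \<vartheta>)" using assms t by simp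
    then show ?thesis using t by (simp add: field_simps)
  qed
  finally show ?thesis using ln_theta by simp
qed

lemma profile_slope_neg:
  assumes "\<vartheta> < x" "x < 1"
  shows "2 * x - 2 - ln x < 0"
proof -
  have t: "0 < \<vartheta>" using theta_ge by simp
  have less: "ln y < y - 1" if "0 < y" "y \<noteq> 1" for y :: real
    using that ln_le_minus_one[of y] ln_eq_minus_one[of y] by fastforce
  show ?thesis
  proof (cases "x \<le> 1 / 2")
    case True
    have "ln \<vartheta> - ln x = ln (\<vartheta> / x)" using assms t by (simp add: ln_div)
    also have "\<dots> < \<vartheta> / x - 1" using assms t by (intro less) auto
    also have "\<dots> \<le> 2 * (\<vartheta> - x)"
    proof -
      have "0 \<le> (x - \<vartheta>) * (1 - 2 * x)" using assms True by simp
      then show ?thesis using assms t by (simp add: field_simps)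
    qed
    finally show ?thesis using ln_theta by simp
  next
    case False
    have "- ln x = ln (1 / x)" using assms t by (simp add: ln_div)
    also have "\<dots> < 1 / x - 1" using assms t by (intro less) auto
    also have "\<dots> \<le> 2 * (1 - x)"
    proof -
      have "0 \<le> (1 - x) * (2 * x - 1)" using assms False by simp
      then show ?thesis using assms t by (simp add: field_simps)
    qed
    finally show ?thesis by simp
  qed
qed

lemma profile_strict_increasing:
  assumes "0 < x" "x < y" "y \<le> \<vartheta>"
  shows "profile x < profile y"
proof (rule DERIV_pos_imp_increasing_open[OF \<open>x < y\<close>])
  fix z assume "x < z" "z < y"
  then show "\<exists>d. (profile has_real_derivative d) (at z) \<and> 0 < d"
    using assms profile_has_derivative[of z] profile_slope_pos[of z]
    by (intro exI[of _ "2 * (2 * z - 2 - ln z)"]) auto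
qed (use assms in \<open>auto intro: continuous_on_subset[OF continuous_on_profile]\<close>)

lemma profile_strict_decreasing:
  assumes "\<vartheta> \<le> x" "x < y" "y \<le> 1"
  shows "profile y < profile x"
proof (rule DERIV_neg_imp_decreasing_open[OF \<open>x < y\<close>])
  fix z assume "x < z" "z < y"
  then show "\<exists>d. (profile has_real_derivative d) (at z) \<and> d < 0"
    using assms theta_ge profile_has_derivative[of z] profile_slope_neg[of z]
    by (intro exI[of _ "2 * (2 * z - 2 - ln z)"]) auto
qed (use assms theta_ge in \<open>auto intro!: continuous_on_subset[OF continuous_on_profile]\<close>)

lemma profile_le_theta:
  assumes "0 < x" "x \<le> 1"
  shows "profile x \<le> profile \<vartheta>"
  using assms profile_strict_increasing[of x \<vartheta>] profile_strict_decreasing[of \<vartheta> x]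
  by (cases x \<vartheta> rule: linorder_cases) auto

text \<open>
  By unimodality, a point at distance at least \<open>e\<close> from \<open>\<vartheta>\<close> has a value at most
  \<open>max (f (\<vartheta> - e)) (f (\<vartheta> + e))\<close>, which is below the maximum. So values that converge to the
  maximum force the points to converge.
\<close>

lemma maximizing_sequence_tendsto_theta:
  assumes x: "\<forall>\<^sub>F n in sequentially. 0 < x n \<and> x n \<le> 1"
    and lim: "(\<lambda>n. profile (x n)) \<longlonglongrightarrow> profile \<vartheta>"
  shows "x \<longlonglongrightarrow> \<vartheta>"
proof (rule order_tendstoI)
  fix a assume "a < \<vartheta>"
  define c where "c = max a (\<vartheta> / 2)"
  have c: "0 < c" "c < \<vartheta>" "a \<le> c" using \<open>a < \<vartheta>\<close> theta_ge by (auto simp: c_def)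
  have "profile c < profile \<vartheta>" using c by (intro profile_strict_increasing) auto
  then have "\<forall>\<^sub>F n in sequentially. profile c < profile (x n)"
    by (rule order_tendstoD[OF lim])
  with x show "\<forall>\<^sub>F n in sequentially. a < x n"
  proof eventually_elim
    case (elim n)
    then show ?case using c profile_strict_increasing[of "x n" c]
      by (cases "x n" c rule: linorder_cases) auto
  qed
next
  fix a assume "\<vartheta> < a"
  define c where "c = min a 1"
  have c: "\<vartheta> < c" "c \<le> 1" "c \<le> a" using \<open>\<vartheta> < a\<close> theta_less by (auto simp: c_def)
  have "profile c < profile \<vartheta>" using c by (intro profile_strict_decreasing) auto
  then have "\<forall>\<^sub>F n in sequentially. profile c < profile (x n)"
    by (rule order_tendstoD[OF lim])
  with x show "\<forall>\<^sub>F n in sequentially. x n < a"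
  proof eventually_elim
    case (elim n)
    then show ?case using c profile_strict_decreasing[of c "x n"]
      by (cases "x n" c rule: linorder_cases) auto
  qed
qed

section \<open>Limits and monotonicity of the maximal success probability\<close>

lemma success_prob_le:
  assumes "1 \<le> r" "r \<le> n"
  shows "success_prob r n \<le> profile \<vartheta> + 2 / n"
  using success_prob_bounds(2)[OF assms] profile_le_theta[of "r / n"] assms by simp

lemma tendsto_add_2_over_n: "(\<lambda>n. c + 2 / real n) \<longlonglongrightarrow> c"
  using tendsto_add[OF tendsto_const[of c] lim_const_over_n[of "2 :: real"]] by simp

lemma floor_theta_in_range:
  assumes "5 \<le> n"
  shows "nat \<lfloor>\<vartheta> * real n\<rfloor> \<in> {1..n}"
proof -
  have "1 \<le> \<vartheta> * real n"
    using mult_mono[of "0.2" \<vartheta> 5 "real n"] theta_ge assms by simp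
  moreover have "\<vartheta> * real n \<le> 1 * real n"
    using theta_less by (intro mult_right_mono) auto
  ultimately show ?thesis by (simp add: le_nat_iff nat_le_iff floor_le_iff le_floor_iff)
qed

lemma success_prob_floor_theta_tendsto:
  "(\<lambda>n. success_prob (nat \<lfloor>\<vartheta> * real n\<rfloor>) n) \<longlonglongrightarrow> profile \<vartheta>"
proof -
  let ?r = "\<lambda>n. nat \<lfloor>\<vartheta> * real n\<rfloor>"
  have ratio: "(\<lambda>n. real (?r n) / real n) \<longlonglongrightarrow> \<vartheta>"
  proof (rule tendsto_sandwich)
    have bounds: "\<vartheta> * real n - 1 \<le> real (?r n)" "real (?r n) \<le> \<vartheta> * real n" for n
      using theta_ge by (auto simp: of_nat_nat)
    show "\<forall>\<^sub>F n in sequentially. \<vartheta> - 1 / real n \<le> real (?r n) / real n"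
      using eventually_gt_at_top[of 0]
    proof eventually_elim
      case (elim n)
      then show ?case
        using divide_right_mono[OF bounds(1)[of n], of "real n"] by (simp add: diff_divide_distrib)
    qed
    show "\<forall>\<^sub>F n in sequentially. real (?r n) / real n \<le> \<vartheta>"
      using eventually_gt_at_top[of 0]
    proof eventually_elim
      case (elim n)
      then show ?case using divide_right_mono[OF bounds(2)[of n], of "real n"] by simp
    qed
    show "(\<lambda>n. \<vartheta> - 1 / real n) \<longlonglongrightarrow> \<vartheta>"
      using tendsto_diff[OF tendsto_const[of \<vartheta>] lim_const_over_n[of "1 :: real"]] by simp
  qed simp
  have "isCont profile \<vartheta>"
    using profile_has_derivative[of \<vartheta>] theta_ge by (intro DERIV_isCont) auto
  then have lower: "(\<lambda>n. profile (real (?r n) / real n)) \<longlonglongrightarrow> profile \<vartheta>"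
    using ratio by (rule isCont_tendsto_compose)
  show ?thesis
  proof (rule tendsto_sandwich[OF _ _ lower tendsto_add_2_over_n])
    show "\<forall>\<^sub>F n in sequentially. profile (real (?r n) / real n) \<le> success_prob (?r n) n"
      using eventually_ge_at_top[of 5]
      by eventually_elim (use floor_theta_in_range in \<open>auto intro!: success_prob_bounds\<close>)
    show "\<forall>\<^sub>F n in sequentially. success_prob (?r n) n \<le> profile \<vartheta> + 2 / real n"
      using eventually_ge_at_top[of 5]
      by eventually_elim (use floor_theta_in_range in \<open>auto intro!: success_prob_le\<close>)
  qed
qed

theorem theorem2:
  fixes m :: "nat \<Rightarrow> nat" and PP :: "nat \<Rightarrow> real"
  assumes "m 1 = 0" and "m 2 = 0"
    and "\<And>n. n \<ge> 3 \<Longrightarrow> is_arg_max (\<lambda>r. success_prob r n) (\<lambda>r. r \<in> {1..n}) (m n)"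
    and "PP 1 = 1" and "PP 2 = 1"
    and "\<And>n. n \<ge> 3 \<Longrightarrow> PP n = success_prob (m n) n"
  shows "(0.20318786 \<le> \<vartheta> \<and> \<vartheta> < 0.20318787) \<and>
    (1 = PP 1 \<and> PP 1 = PP 2 \<and>
      (\<forall>n\<ge>2. PP n > PP (n + 1)) \<and>
      (\<forall>n\<ge>1. PP n > 2 * (\<vartheta> - \<vartheta>\<^sup>2))) \<and>
    (\<lambda>n. real (m n) / real n) \<longlonglongrightarrow> \<vartheta> \<and>
    (\<lambda>n. success_prob (nat \<lfloor>\<vartheta> * real n\<rfloor>) n) \<longlonglongrightarrow> 2 * (\<vartheta> - \<vartheta>\<^sup>2) \<and>
    PP \<longlonglongrightarrow> 2 * (\<vartheta> - \<vartheta>\<^sup>2)"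
proof -
  have m: "m n \<in> {1..n}" if "3 \<le> n" for n
    using assms(3)[OF that] by (auto simp: is_arg_max_def)
  have PP_ge: "success_prob r n \<le> PP n" if "3 \<le> n" "r \<in> {1..n}" for n r
    using assms(3)[OF that(1)] assms(6)[OF that(1)] that(2)
    by (auto simp: is_arg_max_linorder)
  have PP_le: "PP n \<le> profile (real (m n) / real n) + 2 / real n" if "3 \<le> n" for n
    using success_prob_bounds(2)[of "m n" n] m[OF that] assms(6)[OF that] by simp
  have PP_lim: "PP \<longlonglongrightarrow> profile \<vartheta>"
  proof (rule tendsto_sandwich[OF _ _ success_prob_floor_theta_tendsto tendsto_add_2_over_n])
    show "\<forall>\<^sub>F n in sequentially. success_prob (nat \<lfloor>\<vartheta> * real n\<rfloor>) n \<le> PP n"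
      using eventually_ge_at_top[of 5]
      by eventually_elim (use PP_ge floor_theta_in_range in auto)
    show "\<forall>\<^sub>F n in sequentially. PP n \<le> profile \<vartheta> + 2 / real n"
      using eventually_ge_at_top[of 3]
      by eventually_elim (use assms(6) m in \<open>auto intro!: success_prob_le\<close>)
  qed
  have "(\<lambda>n. real (m n) / real n) \<longlonglongrightarrow> \<vartheta>"
  proof (rule maximizing_sequence_tendsto_theta)
    show range: "\<forall>\<^sub>F n in sequentially. 0 < real (m n) / real n \<and> real (m n) / real n \<le> 1"
      using eventually_ge_at_top[of 3]
    proof eventually_elim
      case (elim n)
      then show ?case using m[OF elim] by simp
    qed
    show "(\<lambda>n. profile (real (m n) / real n)) \<longlonglongrightarrow> profile \<vartheta>"
    proof (rule tendsto_sandwich)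
      show "(\<lambda>n. PP n - 2 / real n) \<longlonglongrightarrow> profile \<vartheta>"
        using tendsto_diff[OF PP_lim lim_const_over_n[of "2 :: real"]] by simp
      show "\<forall>\<^sub>F n in sequentially. PP n - 2 / real n \<le> profile (real (m n) / real n)"
        using eventually_ge_at_top[of 3] by eventually_elim (use PP_le in \<open>simp add: algebra_simps\<close>)
      show "\<forall>\<^sub>F n in sequentially. profile (real (m n) / real n) \<le> profile \<vartheta>"
        using range by eventually_elim (auto intro: profile_le_theta)
    qed simp
  qed
  moreover have dec: "PP (n + 1) < PP n" if "2 \<le> n" for n
  proof (cases "n = 2")
    case True
    have "m 3 = 1 \<or> m 3 = 2 \<or> m 3 = 3" using m[of 3] by auto
    then have "success_prob (m 3) 3 < 1"
      by (elim disjE) (simp_all add: success_prob_eq harm_expand)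
    then show ?thesis using True assms(5) assms(6)[of 3] by simp
  next
    case False
    with that have n: "3 \<le> n" by simp
    obtain r where "r \<in> {1..n}" "success_prob (m (n + 1)) (n + 1) < success_prob r n"
      using success_prob_Suc_dominated[OF n m[of "n + 1"]] n by auto
    then show ?thesis using PP_ge[OF n] assms(6)[of "n + 1"] n by fastforce
  qed
  moreover have "profile \<vartheta> < PP n" if "1 \<le> n" for n
  proof -
    have above: "profile \<vartheta> < PP k" if "2 \<le> k" for k
    proof -
      have "PP j \<le> PP (k + 1)" if "k + 1 \<le> j" for j
        using that
      proof (induction j rule: dec_induct)
        case (step i)
        then show ?case using dec[of i] \<open>2 \<le> k\<close> by simp
      qed simp
      then have "profile \<vartheta> \<le> PP (k + 1)"
        by (intro LIMSEQ_le_const2[OF PP_lim]) blast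
      also have "\<dots> < PP k" using that by (rule dec)
      finally show ?thesis .
    qed
    show ?thesis
      using above[of n] above[of 2] that assms(4,5) by (cases "n = 1") auto
  qed
  ultimately show ?thesis
    using theta_ge theta_less assms(4,5) PP_lim success_prob_floor_theta_tendsto
    by (simp add: profile_theta)
qed

end
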